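(* Fix an outer iteration $k$ of the Inexact Bregman Sparse Newton (IBSN) algorithm, let $\{\gamma^{k,v}\}_v$ be its sequence of inner iterates, and let $\gamma^{k,\star}$ denote the unique minimizer of $\mathcal L^k$ in the slice $\{\gamma\in\mathbb{R}^n:\mathbf 1_n^\top\gamma=0\}$. Assume that the Hessian $H^k=\nabla^2\mathcal L^k$ is Lipschitz continuous with constant $L_H$ in a neighborhood $U$ of $\gamma^{k,\star}$. Then there exists a constant $L>0$ such that, for every $v\ge1$ for which $\gamma^{k,v}\in U$ and the unit stepsize $t^{k,v}=1$ is accepted, $$\|\gamma^{k,v+1}-\gamma^{k,\star}\|\le L\,\|\gamma^{k,v}-\gamma^{k,\star}\|^2 .$$
   Context: Data: integers $m,n\ge1$, $C\in\mathbb{R}^{m\times n}$ with nonnegative entries, $a\in\mathbb{R}^m$, $b\in\mathbb{R}^n$ with strictly positive entries and $\sum_i a_i=\sum_j b_j=1$, $\eta>0$, and the $k$-th outer iterate $X^k\in\mathbb{R}^{m\times n}$, which has strictly positive entries ($X^0=ab^\top$). $\|\cdot\|$ is the Euclidean norm of vectors and the spectral norm of matrices. Functions: $$Z^k(\gamma,\zeta)=-a^\top\zeta-b^\top\gamma+\eta\sum_{i,j}X^k_{ij}\exp((\zeta_i+\gamma_j-C_{ij})/\eta),$$ $$\mathcal L^k(\gamma)=-\sum_j\gamma_jb_j+\eta\sum_i a_i\log\Big(\sum_jX^k_{ij}\exp((\gamma_j-C_{ij})/\eta)\Big),$$ $$[P^k(\gamma)]_{ij}=\frac{X^k_{ij}\exp((\gamma_j-C_{ij})/\eta)}{\sum_{l}X^k_{il}\exp((\gamma_l-C_{il})/\eta)},\qquad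 g^k(\gamma)=\nabla\mathcal L^k(\gamma)=P^k(\gamma)^\top a-b,$$ $$H^k(\gamma)=\nabla^2\mathcal L^k(\gamma)=\tfrac1\eta\big(\mathrm{diag}(P^k(\gamma)^\top a)-P^k(\gamma)^\top\mathrm{diag}(a)P^k(\gamma)\big).$$ Sparsified Hessian: fix $i^\star\in\arg\max_ia_i$. For $\rho\ge0$ and $P=P^k(\gamma)$, let $[P_\rho]_{ij}=P_{ij}\mathbf 1_{\{P_{ij}\ge\rho\}}/\sum_lP_{il}\mathbf 1_{\{P_{il}\ge\rho\}}$ for $i\ne i^\star$ and $[P_\rho]_{i^\star j}=P_{i^\star j}$, and $H^k_\rho(\gamma)=\frac1\eta(\mathrm{diag}(P_\rho^\top a)-P_\rho^\top\mathrm{diag}(a)P_\rho)$. It is assumed that all normalizing denominators occurring in the run are nonzero. Inner loop of IBSN at outer iteration $k$, started from $(\gamma^{k,0},\zeta^{k,0})$ with $\mathbf 1_n^\top\gamma^{k,0}=0$: first run finitely many iterations of the Sinkhorn algorithm (alternating exact minimization of $Z^k$ in $\zeta$ and in $\gamma$) to obtain $\gamma^{k,1}$, and replace $\gamma^{k,1}$ by $\gamma^{k,1}-\frac1n(\mathbf 1_n^\top\gamma^{k,1})\mathbf 1_n$. Then for $v=1,2,\dots$: set $g^{k,v}=g^k(\gamma^{k,v})$, $\rho=\frac{\eta}{mn}\|g^{k,v}\|$, $H^{k,v}_\rho=H^k_\rho(\gamma^{k,v})$, $\Delta\gamma^{k,v}=-(H^{k,v}_\rho+\|g^{k,v}\|I)^{-1}g^{k,v}$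 (with $\Delta\gamma^{k,v}=0$ if $g^{k,v}=0$), choose $t^{k,v}$ by Armijo backtracking, i.e. $t^{k,v}$ is the largest element of $\{1,\beta,\beta^2,\dots\}$ with $\mathcal L^k(\gamma^{k,v}+t\Delta\gamma^{k,v})\le\mathcal L^k(\gamma^{k,v})+\sigma t\,(g^{k,v})^\top\Delta\gamma^{k,v}$, where $\sigma=10^{-4}$, $\beta=0.8$, and set $\gamma^{k,v+1}=\gamma^{k,v}+t^{k,v}\Delta\gamma^{k,v}$. The algorithm's early-termination test is ignored here. *)

theory Defs
  imports "HOL-Analysis.Analysis"
begin

text \<open>
  The dimensions are the cardinalities of the finite index types \<open>'m\<close> and \<open>'n\<close>; an
  \<open>m \<times> n\<close> matrix has type \<open>real ^ 'n ^ 'm\<close>, with entries \<open>A $ i $ j\<close>. Throughout, \<open>X\<close> stands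
  for the outer iterate \<open>X^k\<close> (the index \<open>k\<close> is fixed and suppressed).
\<close>

text \<open>The class norm on \<open>real ^ 'n ^ 'm\<close> is the Frobenius norm, hence the need for:\<close>

definition spectral_norm :: "real ^ 'n ^ 'm \<Rightarrow> real" where
  "spectral_norm A = onorm ((*v) A)"

definition diag_mat :: "real ^ 'n \<Rightarrow> real ^ 'n ^ 'n" where
  "diag_mat v = (\<chi> i j. if i = j then v $ i else 0)"

definition dual_Z ::
  "real \<Rightarrow> real ^ 'm \<Rightarrow> real ^ 'n \<Rightarrow> real ^ 'n ^ 'm \<Rightarrow> real ^ 'n ^ 'm \<Rightarrow> real ^ 'n \<Rightarrow> real ^ 'm \<Rightarrow> real"
where
  "dual_Z \<eta> a b C X \<gamma> \<zeta> =
     - (a \<bullet> \<zeta>) - b \<bullet> \<gamma>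
     + \<eta> * (\<Sum>i\<in>UNIV. \<Sum>j\<in>UNIV. X $ i $ j * exp ((\<zeta> $ i + \<gamma> $ j - C $ i $ j) / \<eta>))"

definition semi_dual ::
  "real \<Rightarrow> real ^ 'm \<Rightarrow> real ^ 'n \<Rightarrow> real ^ 'n ^ 'm \<Rightarrow> real ^ 'n ^ 'm \<Rightarrow> real ^ 'n \<Rightarrow> real"
where
  "semi_dual \<eta> a b C X \<gamma> =
     - (\<Sum>j\<in>UNIV. \<gamma> $ j * b $ j)
     + \<eta> * (\<Sum>i\<in>UNIV. a $ i * ln (\<Sum>j\<in>UNIV. X $ i $ j * exp ((\<gamma> $ j - C $ i $ j) / \<eta>)))"

definition plan ::
  "real \<Rightarrow> real ^ 'n ^ 'm \<Rightarrow> real ^ 'n ^ 'm \<Rightarrow> real ^ 'n \<Rightarrow> real ^ 'n ^ 'm"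
where
  "plan \<eta> C X \<gamma> =
     (\<chi> i j. X $ i $ j * exp ((\<gamma> $ j - C $ i $ j) / \<eta>)
            / (\<Sum>l\<in>UNIV. X $ i $ l * exp ((\<gamma> $ l - C $ i $ l) / \<eta>)))"

definition grad ::
  "real \<Rightarrow> real ^ 'm \<Rightarrow> real ^ 'n \<Rightarrow> real ^ 'n ^ 'm \<Rightarrow> real ^ 'n ^ 'm \<Rightarrow> real ^ 'n \<Rightarrow> real ^ 'n"
where
  "grad \<eta> a b C X \<gamma> = transpose (plan \<eta> C X \<gamma>) *v a - b"

definition hess_of_plan :: "real \<Rightarrow> real ^ 'm \<Rightarrow> real ^ 'n ^ 'm \<Rightarrow> real ^ 'n ^ 'n" where
  "hess_of_plan \<eta> a P =
     (1 / \<eta>) *\<^sub>R (diag_mat (transpose P *v a) - transpose P ** diag_mat a ** P)"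

definition hess ::
  "real \<Rightarrow> real ^ 'm \<Rightarrow> real ^ 'n ^ 'm \<Rightarrow> real ^ 'n ^ 'm \<Rightarrow> real ^ 'n \<Rightarrow> real ^ 'n ^ 'n"
where
  "hess \<eta> a C X \<gamma> = hess_of_plan \<eta> a (plan \<eta> C X \<gamma>)"

definition row_mass_above :: "real \<Rightarrow> real ^ 'n ^ 'm \<Rightarrow> 'm \<Rightarrow> real" where
  "row_mass_above \<rho> P i = (\<Sum>l\<in>UNIV. P $ i $ l * of_bool (P $ i $ l \<ge> \<rho>))"

definition sparsify :: "'m \<Rightarrow> real \<Rightarrow> real ^ 'n ^ 'm \<Rightarrow> real ^ 'n ^ 'm" where
  "sparsify istar \<rho> P =
     (\<chi> i j. if i = istar then P $ i $ j
            else P $ i $ j * of_bool (P $ i $ j \<ge> \<rho>) / row_mass_above \<rho> P i)"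

definition threshold ::
  "real \<Rightarrow> real ^ 'm \<Rightarrow> real ^ 'n \<Rightarrow> real ^ 'n ^ 'm \<Rightarrow> real ^ 'n ^ 'm \<Rightarrow> real ^ 'n \<Rightarrow> real"
where
  "threshold \<eta> a b C X \<gamma> = \<eta> / (real CARD('m) * real CARD('n)) * norm (grad \<eta> a b C X \<gamma>)"
  for a :: "real ^ 'm" and b :: "real ^ 'n"

text \<open>
  For \<open>g \<noteq> 0\<close> the regularized matrix is positive definite whenever the normalizing row masses
  are nonzero, so \<open>matrix_inv\<close> is then its genuine inverse.
\<close>

definition newton_dir ::
  "real \<Rightarrow> real ^ 'm \<Rightarrow> real ^ 'n \<Rightarrow> real ^ 'n ^ 'm \<Rightarrow> real ^ 'n ^ 'm \<Rightarrow> 'm \<Rightarrow> real ^ 'n \<Rightarrow> real ^ 'n"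
where
  "newton_dir \<eta> a b C X istar \<gamma> =
     (let g = grad \<eta> a b C X \<gamma>;
          H = hess_of_plan \<eta> a (sparsify istar (threshold \<eta> a b C X \<gamma>) (plan \<eta> C X \<gamma>))
      in if g = 0 then 0 else - (matrix_inv (H + norm g *\<^sub>R mat 1) *v g))"

definition armijo_steps ::
  "(real ^ 'n \<Rightarrow> real) \<Rightarrow> real ^ 'n \<Rightarrow> real ^ 'n \<Rightarrow> real ^ 'n \<Rightarrow> real set"
where
  "armijo_steps f g \<gamma> d =
     {t. (\<exists>s::nat. t = (8/10) ^ s) \<and> f (\<gamma> + t *\<^sub>R d) \<le> f \<gamma> + (1 / 10^4) * t * (g \<bullet> d)}"

text \<open>One Sinkhorn iteration: exact minimization of \<open>dual_Z\<close>, first in \<open>\<zeta>\<close>, then in \<open>\<gamma>\<close>.\<close>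

definition sinkhorn_step ::
  "real \<Rightarrow> real ^ 'm \<Rightarrow> real ^ 'n \<Rightarrow> real ^ 'n ^ 'm \<Rightarrow> real ^ 'n ^ 'm \<Rightarrow>
   (real ^ 'n) \<times> (real ^ 'm) \<Rightarrow> (real ^ 'n) \<times> (real ^ 'm) \<Rightarrow> bool"
where
  "sinkhorn_step \<eta> a b C X = (\<lambda>(\<gamma>, \<zeta>) (\<gamma>', \<zeta>').
     is_arg_min (\<lambda>z. dual_Z \<eta> a b C X \<gamma> z) (\<lambda>_. True) \<zeta>' \<and>
     is_arg_min (\<lambda>y. dual_Z \<eta> a b C X y \<zeta>') (\<lambda>_. True) \<gamma>')"

definition zero_sum :: "real ^ 'n \<Rightarrow> bool" where
  "zero_sum \<gamma> \<longleftrightarrow> (\<Sum>j\<in>UNIV. \<gamma> $ j) = 0"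

definition center :: "real ^ 'n \<Rightarrow> real ^ 'n" where
  "center \<gamma> = (\<chi> i. \<gamma> $ i - (\<Sum>j\<in>UNIV. \<gamma> $ j) / real CARD('n))"
  for \<gamma> :: "real ^ 'n"

text \<open>
  The inner loop without early termination, as a predicate on the sequence of iterates \<open>\<gamma>\<close> and
  the sequence of step sizes \<open>t\<close>. The initial point is \<open>(\<gamma> 0, \<zeta>0)\<close>; \<open>\<gamma> 1\<close> is the centred result
  of the Sinkhorn phase; the Newton iterations are those with \<open>v \<ge> 1\<close>, so \<open>t 0\<close> is irrelevant.
\<close>

definition ibsn_inner_run ::
  "real \<Rightarrow> real ^ 'm \<Rightarrow> real ^ 'n \<Rightarrow> real ^ 'n ^ 'm \<Rightarrow> real ^ 'n ^ 'm \<Rightarrow> 'm \<Rightarrow> real ^ 'm \<Rightarrow>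
   (nat \<Rightarrow> real ^ 'n) \<Rightarrow> (nat \<Rightarrow> real) \<Rightarrow> bool"
where
  "ibsn_inner_run \<eta> a b C X istar \<zeta>0 \<gamma> t \<longleftrightarrow>
     zero_sum (\<gamma> 0) \<and>
     (\<exists>\<gamma>' \<zeta>'. (sinkhorn_step \<eta> a b C X)\<^sup>*\<^sup>* (\<gamma> 0, \<zeta>0) (\<gamma>', \<zeta>') \<and> \<gamma> 1 = center \<gamma>') \<and>
     (\<forall>v\<ge>1.
        let d = newton_dir \<eta> a b C X istar (\<gamma> v);
            T = armijo_steps (semi_dual \<eta> a b C X) (grad \<eta> a b C X (\<gamma> v)) (\<gamma> v) d
        in t v \<in> T \<and> (\<forall>s\<in>T. s \<le> t v) \<and> \<gamma> (v + 1) = \<gamma> v + t v *\<^sub>R d)"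

subsection \<open>The closed forms are the gradient and the Hessian of \<open>semi_dual\<close>\<close>

lemma row_sum_pos:
  fixes X C :: "real ^ 'n ^ 'm"
  assumes "\<And>i j. 0 < X $ i $ j"
  shows "0 < (\<Sum>l\<in>UNIV. X $ i $ l * exp ((\<gamma> $ l - C $ i $ l) / \<eta>))"
  by (rule sum_pos) (use assms in auto)

lemma diag_mat_mult_vec: "diag_mat v *v x = (\<chi> i. v $ i * x $ i)"
  by (simp add: diag_mat_def matrix_vector_mult_def vec_eq_iff if_distrib if_distribR
      cong: if_cong)

lemma semi_dual_has_derivative:
  fixes X C :: "real ^ 'n ^ 'm"
  assumes eta: "\<eta> > 0" and X: "\<And>i j. 0 < X $ i $ j"
  shows "(semi_dual \<eta> a b C X has_derivative (\<lambda>h. grad \<eta> a b C X \<gamma> \<bullet> h)) (at \<gamma>)"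
proof -
  note pos = row_sum_pos[where X = X and C = C, OF X]
  let ?E = "\<lambda>i j. X $ i $ j * exp ((\<gamma> $ j - C $ i $ j) / \<eta>)"
  let ?S = "\<lambda>i. \<Sum>l\<in>UNIV. ?E i l"
  let ?P = "plan \<eta> C X \<gamma>"
  have N: "((\<lambda>x. X $ i $ l * exp ((x $ l - C $ i $ l) / \<eta>)) has_derivative
      (\<lambda>h. ?E i l * h $ l / \<eta>)) (at \<gamma>)" for i l
    by (rule derivative_eq_intros refl bounded_linear.has_derivative[OF bounded_linear_vec_nth]
        | use eta in \<open>simp add: fun_eq_iff divide_inverse\<close>)+
  have D: "((\<lambda>x. \<Sum>l\<in>UNIV. X $ i $ l * exp ((x $ l - C $ i $ l) / \<eta>)) has_derivative
      (\<lambda>h. \<Sum>l\<in>UNIV. ?E i l * h $ l / \<eta>)) (at \<gamma>)" for i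
    by (rule has_derivative_sum) (rule N)
  have Ln: "((\<lambda>x. ln (\<Sum>l\<in>UNIV. X $ i $ l * exp ((x $ l - C $ i $ l) / \<eta>))) has_derivative
      (\<lambda>h. (\<Sum>l\<in>UNIV. ?E i l * h $ l / \<eta>) * inverse (?S i))) (at \<gamma>)" for i
    using has_derivative_ln[OF pos D] .
  have lin: "((\<lambda>x. \<Sum>j\<in>UNIV. x $ j * b $ j) has_derivative (\<lambda>h. \<Sum>j\<in>UNIV. h $ j * b $ j)) (at \<gamma>)"
    by (intro has_derivative_sum has_derivative_mult_left
        bounded_linear.has_derivative[OF bounded_linear_vec_nth] has_derivative_ident)
  have "(semi_dual \<eta> a b C X has_derivative
     (\<lambda>h. - (\<Sum>j\<in>UNIV. h $ j * b $ j)
        + \<eta> * (\<Sum>i\<in>UNIV. a $ i * ((\<Sum>l\<in>UNIV. ?E i l * h $ l / \<eta>) * inverse (?S i))))) (at \<gamma>)"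
    unfolding semi_dual_def[abs_def]
    by (intro has_derivative_add has_derivative_minus has_derivative_mult_right
        has_derivative_sum lin Ln)
  moreover have "- (\<Sum>j\<in>UNIV. h $ j * b $ j)
        + \<eta> * (\<Sum>i\<in>UNIV. a $ i * ((\<Sum>l\<in>UNIV. ?E i l * h $ l / \<eta>) * inverse (?S i)))
      = grad \<eta> a b C X \<gamma> \<bullet> h" for h
  proof -
    have row: "\<eta> * (a $ i * ((\<Sum>l\<in>UNIV. ?E i l * h $ l / \<eta>) * inverse (?S i)))
        = (\<Sum>l\<in>UNIV. ?P $ i $ l * a $ i * h $ l)" for i
      unfolding sum_distrib_left sum_distrib_right
      by (rule sum.cong) (use eta in \<open>simp_all add: plan_def divide_inverse\<close>)
    have "\<eta> * (\<Sum>i\<in>UNIV. a $ i * ((\<Sum>l\<in>UNIV. ?E i l * h $ l / \<eta>) * inverse (?S i)))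
        = (\<Sum>i\<in>UNIV. \<Sum>l\<in>UNIV. ?P $ i $ l * a $ i * h $ l)"
      by (subst sum_distrib_left) (simp only: row)
    also have "\<dots> = (\<Sum>l\<in>UNIV. (\<Sum>i\<in>UNIV. ?P $ i $ l * a $ i) * h $ l)"
      by (subst sum.swap) (simp only: sum_distrib_right)
    finally show ?thesis
      by (simp add: grad_def inner_vec_def matrix_vector_mult_def transpose_def
          left_diff_distrib sum_subtractf mult.commute[of "b $ _"])
  qed
  ultimately show ?thesis by simp
qed

lemma grad_has_derivative:
  fixes X C :: "real ^ 'n ^ 'm"
  assumes eta: "\<eta> > 0" and X: "\<And>i j. 0 < X $ i $ j"
  shows "(grad \<eta> a b C X has_derivative (\<lambda>h. hess \<eta> a C X \<gamma> *v h)) (at \<gamma>)"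
proof (subst has_derivative_componentwise_within, rule ballI)
  fix e :: "real ^ 'n" assume "e \<in> Basis"
  then obtain k where e: "e = axis k 1" by (auto simp: Basis_vec_def)
  note pos = row_sum_pos[where X = X and C = C, OF X]
  let ?E = "\<lambda>i j. X $ i $ j * exp ((\<gamma> $ j - C $ i $ j) / \<eta>)"
  let ?S = "\<lambda>i. \<Sum>l\<in>UNIV. ?E i l"
  let ?P = "plan \<eta> C X \<gamma>"
  have P: "?P $ i $ j = ?E i j / ?S i" for i j by (simp add: plan_def)
  have quot: "((\<lambda>x. X $ i $ k * exp ((x $ k - C $ i $ k) / \<eta>) /
        (\<Sum>l\<in>UNIV. X $ i $ l * exp ((x $ l - C $ i $ l) / \<eta>))) has_derivative
      (\<lambda>h. (1/\<eta>) * (?P $ i $ k * h $ k - ?P $ i $ k * (\<Sum>l\<in>UNIV. ?P $ i $ l * h $ l)))) (at \<gamma>)"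
    for i
  proof -
    have N: "((\<lambda>x. X $ i $ l * exp ((x $ l - C $ i $ l) / \<eta>)) has_derivative
        (\<lambda>h. ?E i l * h $ l / \<eta>)) (at \<gamma>)" for l
      by (rule derivative_eq_intros refl bounded_linear.has_derivative[OF bounded_linear_vec_nth]
          | use eta in \<open>simp add: fun_eq_iff divide_inverse\<close>)+
    have D: "((\<lambda>x. \<Sum>l\<in>UNIV. X $ i $ l * exp ((x $ l - C $ i $ l) / \<eta>)) has_derivative
        (\<lambda>h. \<Sum>l\<in>UNIV. ?E i l * h $ l / \<eta>)) (at \<gamma>)"
      by (rule has_derivative_sum) (rule N)
    have S0: "?S i \<noteq> 0" using pos[of i \<gamma> \<eta>] by simp
    have eq: "(1/\<eta>) * (?P $ i $ k * h $ k - ?P $ i $ k * (\<Sum>l\<in>UNIV. ?P $ i $ l * h $ l))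
      = (?E i k * h $ k / \<eta> * ?S i - ?E i k * (\<Sum>l\<in>UNIV. ?E i l * h $ l / \<eta>)) / (?S i * ?S i)"
      (is "?lhs = ?rhs") for h
    proof -
      have s: "(\<Sum>l\<in>UNIV. ?P $ i $ l * h $ l) = (\<Sum>l\<in>UNIV. ?E i l * h $ l) / ?S i"
        by (simp add: P sum_divide_distrib)
      have s': "(\<Sum>l\<in>UNIV. ?E i l * h $ l / \<eta>) = (\<Sum>l\<in>UNIV. ?E i l * h $ l) / \<eta>"
        by (simp add: sum_divide_distrib)
      have gen: "(1/\<eta>) * (x / S * y - x / S * (q / S)) = (x * y / \<eta> * S - x * (q / \<eta>)) / (S * S)"
        if "S \<noteq> 0" for x y q S :: real
        using that eta by (simp add: field_simps)
      show ?thesis unfolding s s' unfolding P by (rule gen[OF S0])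
    qed
    show ?thesis unfolding eq
      by (rule has_derivative_divide'[OF N D S0])
  qed
  have "((\<lambda>x. (\<Sum>i\<in>UNIV. (X $ i $ k * exp ((x $ k - C $ i $ k) / \<eta>) /
        (\<Sum>l\<in>UNIV. X $ i $ l * exp ((x $ l - C $ i $ l) / \<eta>))) * a $ i) - b $ k) has_derivative
      (\<lambda>h. (\<Sum>i\<in>UNIV. (1/\<eta>) * (?P $ i $ k * h $ k - ?P $ i $ k *
          (\<Sum>l\<in>UNIV. ?P $ i $ l * h $ l)) * a $ i) - 0)) (at \<gamma>)"
    by (intro has_derivative_diff has_derivative_sum has_derivative_mult_left quot
        has_derivative_const)
  moreover have "grad \<eta> a b C X x \<bullet> e = (\<Sum>i\<in>UNIV. (X $ i $ k * exp ((x $ k - C $ i $ k) / \<eta>) /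
        (\<Sum>l\<in>UNIV. X $ i $ l * exp ((x $ l - C $ i $ l) / \<eta>))) * a $ i) - b $ k" for x
    by (simp add: e inner_axis grad_def plan_def transpose_def matrix_vector_mult_def)
  moreover have "(hess \<eta> a C X \<gamma> *v h) \<bullet> e = (\<Sum>i\<in>UNIV. (1/\<eta>) * (?P $ i $ k * h $ k - ?P $ i $ k *
          (\<Sum>l\<in>UNIV. ?P $ i $ l * h $ l)) * a $ i) - 0" for h
  proof -
    have "(hess \<eta> a C X \<gamma> *v h) = (1/\<eta>) *\<^sub>R (diag_mat (transpose ?P *v a) *v h
         - transpose ?P *v (diag_mat a *v (?P *v h)))"
      by (simp add: hess_def hess_of_plan_def scaleR_matrix_vector_assoc[symmetric]
          matrix_vector_mult_diff_rdistrib matrix_vector_mul_assoc matrix_mul_assoc)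
    then have "(hess \<eta> a C X \<gamma> *v h) \<bullet> e = (1/\<eta>) *
       ((\<Sum>i\<in>UNIV. ?P $ i $ k * a $ i) * h $ k
         - (\<Sum>i\<in>UNIV. ?P $ i $ k * (a $ i * (\<Sum>l\<in>UNIV. ?P $ i $ l * h $ l))))"
      by (simp only: e inner_axis diag_mat_mult_vec)
        (simp add: matrix_vector_mult_def vector_matrix_mult_def transpose_def
          del: transpose_matrix_vector)
    also have "\<dots> = (\<Sum>i\<in>UNIV. (1/\<eta>) * (?P $ i $ k * h $ k - ?P $ i $ k *
          (\<Sum>l\<in>UNIV. ?P $ i $ l * h $ l)) * a $ i)"
      unfolding sum_distrib_right sum_subtractf[symmetric] sum_distrib_left[where r = "1/\<eta>"]
      by (rule sum.cong) (simp_all add: algebra_simps)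
    finally show ?thesis by simp
  qed
  ultimately show "((\<lambda>x. grad \<eta> a b C X x \<bullet> e) has_derivative
      (\<lambda>h. (hess \<eta> a C X \<gamma> *v h) \<bullet> e)) (at \<gamma>)"
    by simp
qed

end

theory Submission
  imports Defs
begin

text \<open>
  On zero-sum vectors the sparsified Hessian \<open>H\<close> is uniformly positive definite near the minimizer,
  since the row \<open>istar\<close> of the plan is kept intact and has entries bounded away from \<open>0\<close> on a compact
  ball. Writing \<open>e\<close> for the error and \<open>g\<close> for the gradient, the unit step leaves the error \<open>e'\<close> with
  \<open>(H + norm g *\<^sub>R mat 1) *v e' = (H + norm g *\<^sub>R mat 1) *v e - g\<close>, whose right side is quadratic in
  \<open>e\<close>; coercivity then gives the bound on the ball. Since \<open>U\<close> may be unbounded or disconnected,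
  iterates outside the ball are treated separately: the Newton direction never has norm above 1,
  which is enough there.
\<close>

section \<open>The Hessian of a row-stochastic plan, row by row\<close>

text \<open>For a row-stochastic \<open>Q\<close>, row \<open>i\<close> contributes the covariance
  matrix of its distribution with weight \<open>a $ i\<close>; it acts through the deviations of
  \<open>x\<close> from the row mean \<open>Q $ i \<bullet> x\<close>, on which the estimates below
  work.\<close>

lemma hess_of_plan_nth:
  fixes Q :: "real ^ 'n ^ 'm"
  shows "(hess_of_plan \<eta> a Q *v x) $ j =
    (\<Sum>i\<in>UNIV. a $ i * (Q $ i $ j * (x $ j - Q $ i \<bullet> x))) / \<eta>"
proof -
  have "hess_of_plan \<eta> a Q *v x = (1/\<eta>) *\<^sub>R (diag_mat (transpose Q *v a) *v x
      - transpose Q *v (diag_mat a *v (Q *v x)))"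
    by (simp add: hess_of_plan_def scaleR_matrix_vector_assoc[symmetric]
        matrix_vector_mult_diff_rdistrib matrix_vector_mul_assoc matrix_mul_assoc)
  then have "(hess_of_plan \<eta> a Q *v x) $ j = (1/\<eta>) * ((\<Sum>i\<in>UNIV. Q $ i $ j * a $ i) * x $ j
      - (\<Sum>i\<in>UNIV. Q $ i $ j * (a $ i * (Q $ i \<bullet> x))))"
    by (simp only: diag_mat_mult_vec)
      (simp add: matrix_vector_mult_def vector_matrix_mult_def transpose_def inner_vec_def
        del: transpose_matrix_vector)
  also have "\<dots> = (\<Sum>i\<in>UNIV. a $ i * (Q $ i $ j * (x $ j - Q $ i \<bullet> x))) / \<eta>"
    unfolding sum_distrib_right sum_subtractf[symmetric]
    by (simp add: right_diff_distrib mult.assoc mult.left_commute)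
  finally show ?thesis .
qed

text \<open>The property shared by the plan and its sparsification, so that each estimate stated for
  it serves both.\<close>

definition row_stochastic :: "real ^ 'n ^ 'm \<Rightarrow> bool" where
  "row_stochastic Q \<longleftrightarrow> (\<forall>i j. 0 \<le> Q $ i $ j) \<and> (\<forall>i. (\<Sum>j\<in>UNIV. Q $ i $ j) = 1)"

lemma row_stochastic_le_one:
  assumes "row_stochastic Q" shows "Q $ i $ j \<le> 1"
proof -
  have "Q $ i $ j \<le> (\<Sum>l\<in>UNIV. Q $ i $ l)"
    by (rule member_le_sum) (use assms in \<open>auto simp: row_stochastic_def\<close>)
  then show ?thesis using assms by (simp add: row_stochastic_def)
qed

lemma row_stochastic_inner_le:
  assumes "row_stochastic Q" shows "\<bar>Q $ i \<bullet> x\<bar> \<le> norm x"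
proof -
  have "\<bar>Q $ i \<bullet> x\<bar> \<le> (\<Sum>j\<in>UNIV. \<bar>Q $ i $ j * x $ j\<bar>)"
    by (simp add: inner_vec_def sum_abs)
  also have "\<dots> \<le> (\<Sum>j\<in>UNIV. Q $ i $ j * norm x)"
    using assms by (intro sum_mono)
      (auto simp: row_stochastic_def abs_mult intro!: mult_left_mono component_le_norm_cart)
  also have "\<dots> = norm x"
    using assms by (simp add: row_stochastic_def sum_distrib_right[symmetric])
  finally show ?thesis .
qed

lemma hess_of_plan_quadratic_form:
  assumes Q: "row_stochastic Q"
  shows "x \<bullet> (hess_of_plan \<eta> a Q *v x) =
    (\<Sum>i\<in>UNIV. a $ i * (\<Sum>j\<in>UNIV. Q $ i $ j * (x $ j - Q $ i \<bullet> x)\<^sup>2)) / \<eta>"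
proof -
  have var: "(\<Sum>j\<in>UNIV. x $ j * (Q $ i $ j * (x $ j - Q $ i \<bullet> x))) =
      (\<Sum>j\<in>UNIV. Q $ i $ j * (x $ j - Q $ i \<bullet> x)\<^sup>2)" (is "?l = ?r") for i
  proof -
    let ?c = "Q $ i \<bullet> x"
    \<comment> \<open>Replacing the factor \<open>x $ j\<close> by \<open>x $ j - ?c\<close> changes
      nothing: the weighted deviations sum to zero, as the row mean is \<open>?c\<close> and the row
      mass is 1.\<close>
    have "?l - ?r = ?c * (\<Sum>j\<in>UNIV. Q $ i $ j * x $ j) - ?c\<^sup>2 * (\<Sum>j\<in>UNIV. Q $ i $ j)"
      unfolding sum_subtractf[symmetric] sum_distrib_left
      by (rule sum.cong) (simp_all add: algebra_simps power2_eq_square)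
    also have "\<dots> = 0"
      using Q by (simp add: row_stochastic_def inner_vec_def power2_eq_square)
    finally show ?thesis by simp
  qed
  have "x \<bullet> (hess_of_plan \<eta> a Q *v x) =
      (\<Sum>j\<in>UNIV. \<Sum>i\<in>UNIV. a $ i * (x $ j * (Q $ i $ j * (x $ j - Q $ i \<bullet> x)))) / \<eta>"
    by (simp add: inner_vec_def[of x "_ *v _"] hess_of_plan_nth sum_divide_distrib
        sum_distrib_left mult.left_commute)
  also have "\<dots> = (\<Sum>i\<in>UNIV. a $ i * (\<Sum>j\<in>UNIV. x $ j * (Q $ i $ j * (x $ j - Q $ i \<bullet> x)))) / \<eta>"
    by (subst sum.swap) (simp add: sum_distrib_left)
  finally show ?thesis by (simp only: var)
qed

lemma hess_of_plan_psd:
  assumes "row_stochastic Q" "\<eta> > 0" "\<And>i. a $ i > 0"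
  shows "0 \<le> x \<bullet> (hess_of_plan \<eta> a Q *v x)"
  unfolding hess_of_plan_quadratic_form[OF assms(1)]
  using assms by (intro divide_nonneg_pos sum_nonneg mult_nonneg_nonneg)
    (auto simp: row_stochastic_def less_imp_le)

text \<open>The quadratic form is a weighted sum of the variances of \<open>x\<close> under the rows of \<open>Q\<close>; the
  variance under a single row bounded below already controls \<open>x\<close> modulo constants.\<close>

lemma hess_of_plan_coercive:
  fixes Q :: "real ^ 'n ^ 'm"
  assumes Q: "row_stochastic Q" and eta: "\<eta> > 0" and a: "\<And>i. a $ i > 0"
    and \<delta>: "\<delta> \<ge> 0" "\<And>j. \<delta> \<le> Q $ k $ j" and x: "zero_sum x"
  shows "a $ k * \<delta> / \<eta> * (norm x)\<^sup>2 \<le> x \<bullet> (hess_of_plan \<eta> a Q *v x)"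
proof -
  let ?c = "Q $ k \<bullet> x"
  let ?V = "\<lambda>i. \<Sum>j\<in>UNIV. Q $ i $ j * (x $ j - Q $ i \<bullet> x)\<^sup>2"
  have nn: "(norm x)\<^sup>2 = (\<Sum>j\<in>UNIV. x $ j * x $ j)"
    by (simp add: power2_norm_eq_inner inner_vec_def)
  \<comment> \<open>Shifting a zero-sum vector by a constant cannot shrink its norm, because the
    cross term vanishes.\<close>
  have "(\<Sum>j\<in>UNIV. (x $ j - ?c)\<^sup>2)
      = (\<Sum>j\<in>UNIV. x $ j * x $ j) - 2 * ?c * (\<Sum>j\<in>UNIV. x $ j) + (\<Sum>j\<in>(UNIV::'n set). ?c\<^sup>2)"
    unfolding sum_subtractf[symmetric] sum.distrib[symmetric] sum_distrib_left
    by (rule sum.cong) (simp_all add: algebra_simps power2_eq_square)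
  then have "(norm x)\<^sup>2 \<le> (\<Sum>j\<in>UNIV. (x $ j - ?c)\<^sup>2)"
    using x by (simp add: nn zero_sum_def)
  then have "\<delta> * (norm x)\<^sup>2 \<le> (\<Sum>j\<in>UNIV. \<delta> * (x $ j - ?c)\<^sup>2)"
    using \<delta>(1) by (simp add: sum_distrib_left[symmetric] mult_left_mono)
  also have "\<dots> \<le> ?V k"
    by (intro sum_mono mult_right_mono \<delta>) simp
  finally have "a $ k * (\<delta> * (norm x)\<^sup>2) \<le> a $ k * ?V k"
    using a[of k] by simp
  also have "\<dots> \<le> (\<Sum>i\<in>UNIV. a $ i * ?V i)"
    using a Q by (intro member_le_sum mult_nonneg_nonneg sum_nonneg)
      (auto simp: row_stochastic_def less_imp_le)
  finally show ?thesis
    unfolding hess_of_plan_quadratic_form[OF Q] using eta by (simp add: divide_simps mult.assoc)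
qed

text \<open>In each row the weighted deviations from the mean cancel. The range of the matrix thus
  lies in the zero-sum slice, which keeps the Newton direction there.\<close>

lemma sum_hess_of_plan:
  assumes Q: "row_stochastic Q"
  shows "(\<Sum>j\<in>UNIV. (hess_of_plan \<eta> a Q *v x) $ j) = 0"
proof -
  have "(\<Sum>j\<in>UNIV. Q $ i $ j * (x $ j - Q $ i \<bullet> x)) = 0" for i
    using Q by (simp add: right_diff_distrib sum_subtractf sum_distrib_right[symmetric]
        row_stochastic_def inner_vec_def)
  then have "(\<Sum>i\<in>UNIV. a $ i * (\<Sum>j\<in>UNIV. Q $ i $ j * (x $ j - Q $ i \<bullet> x))) = 0"
    by simp
  then show ?thesis
    unfolding hess_of_plan_nth sum_divide_distrib[symmetric] sum_distrib_left
    by (subst sum.swap) simp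
qed

text \<open>Turns an entrywise error of the plan into an operator error. A product rule in each row
  gives 2 for the changed weight and \<open>CARD('n')\<close> for the changed mean; averaging with
  weights \<open>a\<close> costs nothing, and the outer \<open>CARD('n')\<close> comes from passing
  through the l1 norm.\<close>

lemma hess_of_plan_diff_bound:
  fixes P Q :: "real ^ 'n ^ 'm"
  assumes P: "row_stochastic P" and Q: "row_stochastic Q" and eta: "\<eta> > 0"
    and a: "\<And>i. a $ i > 0" "(\<Sum>i\<in>UNIV. a $ i) = 1"
    and \<epsilon>: "\<And>i j. \<bar>Q $ i $ j - P $ i $ j\<bar> \<le> \<epsilon>"
  shows "norm (hess_of_plan \<eta> a Q *v x - hess_of_plan \<eta> a P *v x)
    \<le> real CARD('n) * ((2 + real CARD('n)) / \<eta>) * \<epsilon> * norm x"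
proof -
  let ?N = "real CARD('n)"
  have e0: "0 \<le> \<epsilon>" using \<epsilon>[of undefined undefined] by linarith
  have row: "\<bar>Q $ i $ j * (x $ j - Q $ i \<bullet> x) - P $ i $ j * (x $ j - P $ i \<bullet> x)\<bar>
      \<le> (2 + ?N) * \<epsilon> * norm x" for i j
  proof -
    have "\<bar>(P $ i - Q $ i) \<bullet> x\<bar> \<le> (\<Sum>l\<in>UNIV. \<bar>(P $ i $ l - Q $ i $ l) * x $ l\<bar>)"
      by (simp add: inner_vec_def sum_abs)
    also have "\<dots> \<le> (\<Sum>l\<in>(UNIV::'n set). \<epsilon> * norm x)"
      using \<epsilon> e0 by (intro sum_mono)
        (auto simp: abs_mult abs_minus_commute[of "P $ _ $ _"] intro!: mult_mono component_le_norm_cart)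
    finally have d: "\<bar>(P $ i - Q $ i) \<bullet> x\<bar> \<le> ?N * \<epsilon> * norm x" by simp
    have "\<bar>x $ j - Q $ i \<bullet> x\<bar> \<le> 2 * norm x"
      using component_le_norm_cart[of x j] row_stochastic_inner_le[OF Q, of i x] by linarith
    then have 1: "\<bar>Q $ i $ j - P $ i $ j\<bar> * \<bar>x $ j - Q $ i \<bullet> x\<bar> \<le> \<epsilon> * (2 * norm x)"
      using \<epsilon> e0 by (intro mult_mono) auto
    have 2: "P $ i $ j * \<bar>(P $ i - Q $ i) \<bullet> x\<bar> \<le> 1 * (?N * \<epsilon> * norm x)"
      using d row_stochastic_le_one[OF P, of i j] P
      by (intro mult_mono) (auto simp: row_stochastic_def)
    have "Q $ i $ j * (x $ j - Q $ i \<bullet> x) - P $ i $ j * (x $ j - P $ i \<bullet> x)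
        = (Q $ i $ j - P $ i $ j) * (x $ j - Q $ i \<bullet> x) + P $ i $ j * ((P $ i - Q $ i) \<bullet> x)"
      by (simp add: algebra_simps inner_diff_left)
    also have "\<bar>\<dots>\<bar> \<le> \<bar>Q $ i $ j - P $ i $ j\<bar> * \<bar>x $ j - Q $ i \<bullet> x\<bar> + P $ i $ j * \<bar>(P $ i - Q $ i) \<bullet> x\<bar>"
      using P by (intro order.trans[OF abs_triangle_ineq]) (simp add: abs_mult row_stochastic_def)
    finally show ?thesis using 1 2 by (simp add: algebra_simps)
  qed
  have "\<bar>(hess_of_plan \<eta> a Q *v x - hess_of_plan \<eta> a P *v x) $ j\<bar> \<le> (2 + ?N) * \<epsilon> * norm x / \<eta>" for j
  proof -
    have "\<bar>(hess_of_plan \<eta> a Q *v x - hess_of_plan \<eta> a P *v x) $ j\<bar> =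
        \<bar>\<Sum>i\<in>UNIV. a $ i * (Q $ i $ j * (x $ j - Q $ i \<bullet> x) - P $ i $ j * (x $ j - P $ i \<bullet> x))\<bar> / \<eta>"
      using eta by (simp add: hess_of_plan_nth diff_divide_distrib[symmetric]
          sum_subtractf[symmetric] right_diff_distrib abs_divide)
    also have "\<dots> \<le> (\<Sum>i\<in>UNIV. a $ i * ((2 + ?N) * \<epsilon> * norm x)) / \<eta>"
    proof (intro divide_right_mono order.trans[OF sum_abs] sum_mono)
      fix i
      show "\<bar>a $ i * (Q $ i $ j * (x $ j - Q $ i \<bullet> x) - P $ i $ j * (x $ j - P $ i \<bullet> x))\<bar>
          \<le> a $ i * ((2 + ?N) * \<epsilon> * norm x)"
        unfolding abs_mult[of "a $ i"] using mult_left_mono[OF row] a(1)[of i] by simp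
    qed (use eta in simp)
    also have "\<dots> = (2 + ?N) * \<epsilon> * norm x / \<eta>"
      using a(2) by (simp add: sum_distrib_right[symmetric])
    finally show ?thesis .
  qed
  then have "norm (hess_of_plan \<eta> a Q *v x - hess_of_plan \<eta> a P *v x)
      \<le> (\<Sum>j\<in>(UNIV::'n set). (2 + ?N) * \<epsilon> * norm x / \<eta>)"
    by (intro order.trans[OF norm_le_l1_cart] sum_mono)
  then show ?thesis by (simp add: mult.assoc)
qed

section \<open>The plan and the error made by sparsifying it\<close>

lemma plan_pos:
  assumes "\<And>i j. 0 < X $ i $ j"
  shows "0 < plan \<eta> C X \<gamma> $ i $ j"
  using assms row_sum_pos[where X = X and C = C, OF assms] by (simp add: plan_def)

lemma row_stochastic_plan:
  assumes "\<And>i j. 0 < X $ i $ j"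
  shows "row_stochastic (plan \<eta> C X \<gamma>)"
  using plan_pos[where X = X, OF assms] row_sum_pos[where X = X and C = C, OF assms, THEN less_imp_neq]
  by (auto simp: row_stochastic_def plan_def less_imp_le sum_divide_distrib[symmetric])

text \<open>The column marginal of the plan and \<open>b\<close> both have total mass 1.\<close>

lemma sum_grad_zero:
  fixes X C :: "real ^ 'n ^ 'm"
  assumes "\<And>i j. 0 < X $ i $ j" "(\<Sum>i\<in>UNIV. a $ i) = 1" "(\<Sum>j\<in>UNIV. b $ j) = 1"
  shows "(\<Sum>j\<in>UNIV. grad \<eta> a b C X y $ j) = 0"
proof -
  have "(\<Sum>j\<in>UNIV. \<Sum>i\<in>UNIV. plan \<eta> C X y $ i $ j * a $ i)
      = (\<Sum>i\<in>UNIV. (\<Sum>j\<in>UNIV. plan \<eta> C X y $ i $ j) * a $ i)"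
    by (subst sum.swap) (simp add: sum_distrib_right)
  also have "\<dots> = 1"
    using row_stochastic_plan[where X = X, OF assms(1)] assms(2)
    by (simp add: row_stochastic_def)
  finally show ?thesis
    using assms(3) by (simp add: grad_def matrix_vector_mult_def transpose_def sum_subtractf
        del: transpose_matrix_vector)
qed

lemma row_stochastic_sparsify:
  assumes P: "row_stochastic P"
    and D: "\<And>i. i \<noteq> istar \<Longrightarrow> row_mass_above \<rho> P i \<noteq> 0"
  shows "row_stochastic (sparsify istar \<rho> P)"
proof -
  have "0 \<le> row_mass_above \<rho> P i" for i
    using P by (auto simp: row_mass_above_def row_stochastic_def intro!: sum_nonneg)
  moreover have "(\<Sum>j\<in>UNIV. P $ i $ j * of_bool (P $ i $ j \<ge> \<rho>) / row_mass_above \<rho> P i) = 1"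
    if "i \<noteq> istar" for i
    using D[OF that] unfolding sum_divide_distrib[symmetric] by (simp add: row_mass_above_def)
  ultimately have "(\<Sum>j\<in>UNIV. sparsify istar \<rho> P $ i $ j) = 1"
      "0 \<le> sparsify istar \<rho> P $ i $ j" for i j
    using P by (cases "i = istar"; simp add: row_stochastic_def sparsify_def)+
  then show ?thesis by (simp add: row_stochastic_def)
qed

text \<open>A row loses at most \<open>CARD('n')\<close> entries, each below \<open>\<rho>\<close>.
  Renormalizing raises a kept entry by at most the lost mass, and a dropped entry was itself below
  \<open>\<rho>\<close>.\<close>

lemma sparsify_diff_bound:
  fixes P :: "real ^ 'n ^ 'm"
  assumes P: "row_stochastic P" and rho: "\<rho> \<ge> 0"
    and D: "\<And>i. i \<noteq> istar \<Longrightarrow> row_mass_above \<rho> P i \<noteq> 0"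
  shows "\<bar>sparsify istar \<rho> P $ i $ j - P $ i $ j\<bar> \<le> real CARD('n) * \<rho>"
proof (cases "i = istar")
  case True
  then show ?thesis using rho by (simp add: sparsify_def)
next
  case False
  let ?D = "row_mass_above \<rho> P i"
  have nn: "0 \<le> P $ i $ l" for l using P by (simp add: row_stochastic_def)
  have "0 \<le> ?D" using nn by (auto simp: row_mass_above_def intro!: sum_nonneg)
  then have Dpos: "?D > 0" using D[OF False] by simp
  have "?D + (\<Sum>l\<in>UNIV. P $ i $ l * of_bool (P $ i $ l < \<rho>)) = (\<Sum>l\<in>UNIV. P $ i $ l)"
    unfolding row_mass_above_def sum.distrib[symmetric] by (rule sum.cong) auto
  then have "1 - ?D = (\<Sum>l\<in>UNIV. P $ i $ l * of_bool (P $ i $ l < \<rho>))"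
    using P by (simp add: row_stochastic_def)
  moreover have "(\<Sum>l\<in>UNIV. P $ i $ l * of_bool (P $ i $ l < \<rho>)) \<le> (\<Sum>l\<in>(UNIV::'n set). \<rho>)"
    using rho by (intro sum_mono) auto
  moreover have "0 \<le> (\<Sum>l\<in>UNIV. P $ i $ l * of_bool (P $ i $ l < \<rho>))"
    using nn by (auto intro!: sum_nonneg)
  ultimately have drop: "0 \<le> 1 - ?D" "1 - ?D \<le> real CARD('n) * \<rho>" by auto
  show ?thesis
  proof (cases "P $ i $ j \<ge> \<rho>")
    case True
    \<comment> \<open>A kept entry is one summand of \<open>?D\<close>, so its rescaled value is at
      most 1.\<close>
    have "P $ i $ j * of_bool (P $ i $ j \<ge> \<rho>) \<le> ?D"
      unfolding row_mass_above_def using nn by (intro member_le_sum) auto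
    then have "P $ i $ j / ?D * (1 - ?D) \<le> 1 * (1 - ?D)"
      using True Dpos drop by (intro mult_right_mono) auto
    moreover have "P $ i $ j / ?D - P $ i $ j = P $ i $ j / ?D * (1 - ?D)"
      using Dpos by (simp add: field_simps)
    moreover have "0 \<le> P $ i $ j / ?D * (1 - ?D)" using nn Dpos drop by simp
    ultimately show ?thesis using True False drop by (simp add: sparsify_def)
  next
    case below: False
    have "1 * \<rho> \<le> real CARD('n) * \<rho>" by (intro mult_right_mono rho) simp
    then have "P $ i $ j \<le> real CARD('n) * \<rho>" using below by linarith
    then show ?thesis using below False nn[of j] by (simp add: sparsify_def)
  qed
qed


section \<open>The regularized Newton direction\<close>

text \<open>The matrix bound to \<open>H\<close> inside \<open>newton_dir\<close>, before the
  shift.\<close>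

definition sparse_hess ::
  "real \<Rightarrow> real ^ 'm \<Rightarrow> real ^ 'n \<Rightarrow> real ^ 'n ^ 'm \<Rightarrow> real ^ 'n ^ 'm \<Rightarrow> 'm \<Rightarrow> real ^ 'n \<Rightarrow> real ^ 'n ^ 'n"
where
  "sparse_hess \<eta> a b C X istar y =
     hess_of_plan \<eta> a (sparsify istar (threshold \<eta> a b C X y) (plan \<eta> C X y))"

lemma sparse_hess_psd:
  fixes X C :: "real ^ 'n ^ 'm"
  assumes eta: "\<eta> > 0" and a: "\<And>i. a $ i > 0" and X: "\<And>i j. 0 < X $ i $ j"
    and D: "\<And>i. i \<noteq> istar \<Longrightarrow>
      row_mass_above (threshold \<eta> a b C X y) (plan \<eta> C X y) i \<noteq> 0"
  shows "0 \<le> x \<bullet> (sparse_hess \<eta> a b C X istar y *v x)"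
  unfolding sparse_hess_def
  by (rule hess_of_plan_psd[OF row_stochastic_sparsify[OF row_stochastic_plan[OF X] D] eta a])

text \<open>The sparsified Hessian is positive semidefinite, so the shift \<open>norm g\<close> makes the regularized
  matrix at least \<open>norm g\<close> times the identity: this gives both its invertibility and a step of
  length at most 1, wherever the iterate is.\<close>

lemma newton_dir_equation:
  fixes X C :: "real ^ 'n ^ 'm"
  assumes eta: "\<eta> > 0" and a: "\<And>i. a $ i > 0" and X: "\<And>i j. 0 < X $ i $ j"
    and D: "\<And>i. i \<noteq> istar \<Longrightarrow>
      row_mass_above (threshold \<eta> a b C X y) (plan \<eta> C X y) i \<noteq> 0"
  defines "d \<equiv> newton_dir \<eta> a b C X istar y" and "g \<equiv> grad \<eta> a b C X y"
    and "H \<equiv> sparse_hess \<eta> a b C X istar y"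
  shows "H *v d + norm g *\<^sub>R d = - g"
proof (cases "g = 0")
  \<comment> \<open>Here the shift vanishes and the matrix annihilates constants, so it is singular;
    the default direction 0 still solves the equation.\<close>
  case True
  then show ?thesis by (simp add: d_def newton_dir_def g_def)
next
  case False
  let ?M = "H + norm g *\<^sub>R mat 1"
  have M: "?M *v x = H *v x + norm g *\<^sub>R x" for x
    by (simp add: matrix_vector_mult_add_rdistrib scaleR_matrix_vector_assoc[symmetric])
  have d: "d = - (matrix_inv ?M *v g)"
    using False by (simp add: d_def newton_dir_def g_def H_def sparse_hess_def Let_def)
  have "x = 0" if "?M *v x = 0" for x
  proof -
    have "0 = x \<bullet> (?M *v x)" using that by simp
    moreover have "0 \<le> x \<bullet> (H *v x)"
      unfolding H_def by (rule sparse_hess_psd[OF eta a X D])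
    ultimately have "norm g * (x \<bullet> x) \<le> 0" by (simp add: M inner_add_right)
    then have "x \<bullet> x \<le> 0" using False by (simp add: mult_le_0_iff)
    then show "x = 0" using inner_ge_zero[of x] by (metis antisym inner_eq_zero_iff)
  qed
  then have "invertible ?M"
    by (auto simp: invertible_left_inverse matrix_left_invertible_ker)
  \<comment> \<open>\<open>matrix_inv\<close> is a Hilbert choice, so its defining property follows
    once some inverse exists.\<close>
  then have "?M ** matrix_inv ?M = mat 1"
    unfolding invertible_def matrix_inv_def by (metis (mono_tags, lifting) someI_ex)
  then have "?M *v (matrix_inv ?M *v g) = g"
    by (simp add: matrix_vector_mul_assoc)
  then have "?M *v d = - g"
    using matrix_vector_mult_diff_distrib[of ?M 0 "matrix_inv ?M *v g"] by (simp add: d)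
  then show ?thesis by (simp add: M)
qed

lemma norm_newton_dir_le_one:
  fixes X C :: "real ^ 'n ^ 'm"
  assumes eta: "\<eta> > 0" and a: "\<And>i. a $ i > 0" and X: "\<And>i j. 0 < X $ i $ j"
    and D: "\<And>i. i \<noteq> istar \<Longrightarrow>
      row_mass_above (threshold \<eta> a b C X y) (plan \<eta> C X y) i \<noteq> 0"
  defines "d \<equiv> newton_dir \<eta> a b C X istar y"
  shows "norm d \<le> 1"
proof (cases "grad \<eta> a b C X y = 0")
  case True
  then show ?thesis by (simp add: d_def newton_dir_def)
next
  case False
  let ?g = "grad \<eta> a b C X y" and ?H = "sparse_hess \<eta> a b C X istar y"
  have "0 \<le> d \<bullet> (?H *v d)" by (rule sparse_hess_psd[OF eta a X D])
  \<comment> \<open>The Newton equation is tested with \<open>d\<close> itself; semidefiniteness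
    allows the Hessian term to be dropped.\<close>
  then have "norm ?g * (norm d)\<^sup>2 \<le> d \<bullet> (?H *v d + norm ?g *\<^sub>R d)"
    by (simp add: inner_add_right power2_norm_eq_inner)
  also have "?H *v d + norm ?g *\<^sub>R d = - ?g"
    unfolding d_def by (rule newton_dir_equation[where X = X, OF eta a X D])
  also have "d \<bullet> - ?g \<le> norm d * norm ?g"
    using norm_cauchy_schwarz[of d "- ?g"] by simp
  finally have "norm ?g * (norm d * norm d) \<le> norm ?g * norm d"
    by (simp add: power2_eq_square mult.commute)
  then have "norm d * norm d \<le> norm d * 1"
    using False by (simp add: mult_le_cancel_left)
  then show ?thesis
    by (cases "d = 0") (simp_all add: mult_le_cancel_left)
qed

text \<open>Summing the coordinates of the Newton equation kills the Hessian term and the gradient;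
  what remains is the gradient norm times the coordinate sum of \<open>d\<close>.\<close>

lemma zero_sum_newton_dir:
  fixes X C :: "real ^ 'n ^ 'm"
  assumes eta: "\<eta> > 0" and a: "\<And>i. a $ i > 0" "(\<Sum>i\<in>UNIV. a $ i) = 1"
    and b: "(\<Sum>j\<in>UNIV. b $ j) = 1" and X: "\<And>i j. 0 < X $ i $ j"
    and D: "\<And>i. i \<noteq> istar \<Longrightarrow>
      row_mass_above (threshold \<eta> a b C X y) (plan \<eta> C X y) i \<noteq> 0"
  defines "d \<equiv> newton_dir \<eta> a b C X istar y"
  shows "zero_sum d"
proof (cases "grad \<eta> a b C X y = 0")
  case True
  then show ?thesis by (simp add: d_def newton_dir_def zero_sum_def)
next
  case False
  let ?g = "grad \<eta> a b C X y" and ?H = "sparse_hess \<eta> a b C X istar y"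
  have "?H *v d + norm ?g *\<^sub>R d = - ?g"
    unfolding d_def by (rule newton_dir_equation[where X = X, OF eta a(1) X D])
  then have "(\<Sum>j\<in>UNIV. (?H *v d + norm ?g *\<^sub>R d) $ j) = (\<Sum>j\<in>UNIV. (- ?g) $ j)"
    by (rule arg_cong)
  moreover have "(\<Sum>j\<in>UNIV. (?H *v d) $ j) = 0"
    unfolding sparse_hess_def
    by (rule sum_hess_of_plan[OF row_stochastic_sparsify[OF row_stochastic_plan[OF X] D]])
  ultimately show ?thesis
    using False sum_grad_zero[where X = X and b = b, OF X a(2) b]
    by (simp add: sum.distrib sum_negf sum_distrib_left[symmetric] zero_sum_def)
qed

section \<open>First-order optimality of the minimizer\<close>

text \<open>The minimizer is only minimal within the slice, but the gradient is itself zero-sum.\<close>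

lemma grad_minimizer_eq_0:
  fixes X C :: "real ^ 'n ^ 'm"
  assumes eta: "\<eta> > 0" and a: "(\<Sum>i\<in>UNIV. a $ i) = 1"
    and b: "(\<Sum>j\<in>UNIV. b $ j) = 1" and X: "\<And>i j. 0 < X $ i $ j"
    and min: "is_arg_min (semi_dual \<eta> a b C X) zero_sum y"
  shows "grad \<eta> a b C X y = 0"
proof -
  let ?f = "semi_dual \<eta> a b C X" and ?g = "grad \<eta> a b C X y"
  \<comment> \<open>The line through \<open>y\<close> along the gradient stays in the slice, so
    \<open>?f\<close> restricted to it is minimal at 0. Its derivative there vanishes, and at
    increment 1 that derivative is the squared gradient norm.\<close>
  have "((\<lambda>s. ?f (y + s *\<^sub>R ?g)) has_derivative (\<lambda>s. ?g \<bullet> (s *\<^sub>R ?g))) (at 0)"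
  proof (rule has_derivative_compose[of "\<lambda>s. y + s *\<^sub>R ?g" "\<lambda>s. s *\<^sub>R ?g" 0 UNIV ?f])
    show "((\<lambda>s. y + s *\<^sub>R ?g) has_derivative (\<lambda>s. s *\<^sub>R ?g)) (at 0)"
      by (auto intro!: derivative_eq_intros)
    show "(?f has_derivative (\<bullet>) ?g) (at (y + 0 *\<^sub>R ?g))"
      using semi_dual_has_derivative[where X = X, OF eta X] by simp
  qed
  moreover have "\<forall>s\<in>ball 0 1. ?f (y + 0 *\<^sub>R ?g) \<le> ?f (y + s *\<^sub>R ?g)"
  proof
    fix s :: real
    have "zero_sum (y + s *\<^sub>R ?g)"
      using min sum_grad_zero[where X = X and b = b, OF X a b]
      by (simp add: is_arg_min_def zero_sum_def sum.distrib sum_distrib_left[symmetric])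
    then show "?f (y + 0 *\<^sub>R ?g) \<le> ?f (y + s *\<^sub>R ?g)"
      using min by (auto simp: is_arg_min_def not_less)
  qed
  ultimately have "(\<lambda>s. ?g \<bullet> (s *\<^sub>R ?g)) = (\<lambda>_. 0)"
    by (intro differential_zero_maxmin[of 0 "ball 0 1"]) auto
  then have "?g \<bullet> (1 *\<^sub>R ?g) = 0" by metis
  then show ?thesis by simp
qed

section \<open>Uniform positivity of a plan row and linearization of the gradient\<close>

lemma continuous_on_plan_nth:
  assumes "\<And>i j. 0 < X $ i $ j"
  shows "continuous_on S (\<lambda>y. plan \<eta> C X y $ i $ j)"
  unfolding plan_def
  using row_sum_pos[where X = X and C = C, OF assms, THEN less_imp_neq]
  by (auto intro!: continuous_intros simp: divide_inverse)

text \<open>Each entry of the row is continuous and positive, hence attains a positive minimum on a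
  nonempty compact set; \<open>\<delta>\<close> is the least of these finitely many minima.\<close>

lemma plan_row_lower_bound:
  fixes X C :: "real ^ 'n ^ 'm"
  assumes X: "\<And>i j. 0 < X $ i $ j" and S: "compact S"
  obtains \<delta> where "\<delta> > 0" "\<And>y j. y \<in> S \<Longrightarrow> \<delta> \<le> plan \<eta> C X y $ k $ j"
proof (cases "S = {}")
  case True
  then show ?thesis using that[of 1] by simp
next
  case False
  have "\<exists>y\<in>S. \<forall>z\<in>S. plan \<eta> C X y $ k $ j \<le> plan \<eta> C X z $ k $ j" for j
    by (rule continuous_attains_inf[OF S False continuous_on_plan_nth[OF X]])
  then obtain m where m: "\<And>j. m j \<in> S"
      "\<And>j z. z \<in> S \<Longrightarrow> plan \<eta> C X (m j) $ k $ j \<le> plan \<eta> C X z $ k $ j"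
    by metis
  let ?\<delta> = "Min (range (\<lambda>j. plan \<eta> C X (m j) $ k $ j))"
  have "?\<delta> > 0" using plan_pos[where X = X, OF X] by simp
  moreover have "?\<delta> \<le> plan \<eta> C X y $ k $ j" if "y \<in> S" for y j
    by (rule order.trans[OF _ m(2)[OF that]]) simp
  ultimately show ?thesis by (rule that)
qed

text \<open>Mean value inequality along the segment, where the Hessian varies by at most
  \<open>\<bar>L\<bar> * norm (z - y)\<close>. This loses a harmless factor 2 against the integral
  remainder; the absolute value covers an \<open>L\<close> of unknown sign.\<close>

lemma grad_linearization:
  fixes X C :: "real ^ 'n ^ 'm"
  assumes eta: "\<eta> > 0" and X: "\<And>i j. 0 < X $ i $ j"
    and segment: "closed_segment y z \<subseteq> U"
    and lip: "\<And>x y. x \<in> U \<Longrightarrow> y \<in> U \<Longrightarrow>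
      spectral_norm (hess \<eta> a C X x - hess \<eta> a C X y) \<le> L * norm (x - y)"
  shows "norm (grad \<eta> a b C X z - grad \<eta> a b C X y - hess \<eta> a C X y *v (z - y))
    \<le> \<bar>L\<bar> * (norm (z - y))\<^sup>2"
proof -
  let ?S = "closed_segment y z"
  have "norm (grad \<eta> a b C X z - grad \<eta> a b C X y - hess \<eta> a C X y *v (z - y))
      \<le> norm (z - y) * (\<bar>L\<bar> * norm (z - y))"
  proof (rule differentiable_bound_linearization[where S = ?S and f' = "\<lambda>x. (*v) (hess \<eta> a C X x)"])
    show "y + t *\<^sub>R (z - y) \<in> ?S" if "t \<in> {0..1}" for t
      using that by (auto simp: in_segment algebra_simps intro!: exI[of _ t])
    show "(grad \<eta> a b C X has_derivative (*v) (hess \<eta> a C X x)) (at x within ?S)" for x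
      by (rule has_derivative_at_withinI[OF grad_has_derivative[where X = X, OF eta X]])
    show "onorm ((*v) (hess \<eta> a C X x) - (*v) (hess \<eta> a C X y)) \<le> \<bar>L\<bar> * norm (z - y)"
      if x: "x \<in> ?S" for x
    proof -
      have "(*v) (hess \<eta> a C X x) - (*v) (hess \<eta> a C X y)
          = (*v) (hess \<eta> a C X x - hess \<eta> a C X y)"
        by (simp add: fun_eq_iff matrix_vector_mult_diff_rdistrib)
      then have "onorm ((*v) (hess \<eta> a C X x) - (*v) (hess \<eta> a C X y)) \<le> L * norm (x - y)"
        using lip[of x y] x segment by (auto simp: spectral_norm_def)
      also have "\<dots> \<le> \<bar>L\<bar> * norm (x - y)" by (intro mult_right_mono) auto
      also have "\<dots> \<le> \<bar>L\<bar> * norm (z - y)"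
        using segment_bound(1)[OF x] by (intro mult_left_mono) auto
      finally show ?thesis .
    qed
  qed simp
  then show ?thesis by (simp add: power2_eq_square algebra_simps)
qed

text \<open>The residual \<open>(H + norm g *\<^sub>R mat 1) *v e - g\<close> splits into the sparsification error applied to
  \<open>e\<close>, the shift \<open>norm g *\<^sub>R e\<close>, and the linearization error of the gradient. The first is quadratic
  in \<open>e = y - z\<close> because the threshold is proportional to \<open>norm g\<close>.\<close>

lemma newton_step_local:
  fixes X C :: "real ^ 'n ^ 'm"
  assumes eta: "\<eta> > 0" and a: "\<And>i. a $ i > 0" "(\<Sum>i\<in>UNIV. a $ i) = 1"
    and b: "(\<Sum>j\<in>UNIV. b $ j) = 1" and X: "\<And>i j. 0 < X $ i $ j"
    and lip: "\<And>x y. x \<in> U \<Longrightarrow> y \<in> U \<Longrightarrow>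
      spectral_norm (hess \<eta> a C X x - hess \<eta> a C X y) \<le> L * norm (x - y)"
    and ball: "ball z r \<subseteq> U" and z: "zero_sum z" "grad \<eta> a b C X z = 0"
  shows "\<exists>K\<ge>0. \<forall>y\<in>ball z r. zero_sum y \<and>
    (\<forall>i. i \<noteq> istar \<longrightarrow> row_mass_above (threshold \<eta> a b C X y) (plan \<eta> C X y) i \<noteq> 0) \<longrightarrow>
    norm (y + newton_dir \<eta> a b C X istar y - z) \<le> K * (norm (y - z))\<^sup>2"
proof -
  \<comment> \<open>The closed ball is compact, so one \<open>\<delta>\<close> serves all its
    points; row \<open>istar\<close> is the one that sparsification leaves intact.\<close>
  obtain \<delta> where \<delta>: "\<delta> > 0" "\<And>y j. y \<in> cball z r \<Longrightarrow> \<delta> \<le> plan \<eta> C X y $ istar $ j"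
    using plan_row_lower_bound[where X = X, OF X compact_cball] by blast
  let ?N = "real CARD('n)" and ?m = "real CARD('m)"
  \<comment> \<open>\<open>\<mu>\<close> is the coercivity constant on the slice and
    \<open>G\<close> bounds the gradient norm per unit of error. \<open>S\<close> is the
    sparsification error per unit of gradient norm: perturbation constant, times
    \<open>CARD('n')\<close>, times the threshold factor. \<open>c\<close> adds up the three parts
    of the residual.\<close>
  define \<mu> where "\<mu> = a $ istar * \<delta> / \<eta>"
  define G where "G = \<bar>L\<bar> * \<bar>r\<bar> + onorm ((*v) (hess \<eta> a C X z))"
  define S where "S = ?N * ((2 + ?N) / \<eta>) * (?N * (\<eta> / (?m * ?N)))"
  define c where "c = S * G + G + \<bar>L\<bar>"
  have mu: "\<mu> > 0" using eta a(1) \<delta>(1) by (simp add: \<mu>_def)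
  have bl: "bounded_linear ((*v) A)" for A :: "real ^ 'n ^ 'n"
    by (rule matrix_vector_mul_bounded_linear)
  have G0: "0 \<le> G" using onorm_pos_le[OF bl] by (simp add: G_def)
  have S0: "0 \<le> S" using eta by (simp add: S_def)
  have c0: "0 \<le> c" using G0 S0 by (simp add: c_def)
  have "norm (y + newton_dir \<eta> a b C X istar y - z) \<le> c / \<mu> * (norm (y - z))\<^sup>2"
    if y: "y \<in> ball z r" and zs: "zero_sum y"
      and D: "\<And>i. i \<noteq> istar \<Longrightarrow> row_mass_above (threshold \<eta> a b C X y) (plan \<eta> C X y) i \<noteq> 0"
    for y
  proof -
    define d g P where "d = newton_dir \<eta> a b C X istar y" "g = grad \<eta> a b C X y"
      "P = plan \<eta> C X y"
    note defs = this
    define \<rho> where "\<rho> = threshold \<eta> a b C X y"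
    define Q where "Q = sparsify istar \<rho> P"
    define H where "H = hess_of_plan \<eta> a Q"
    define e where "e = y - z"
    define e' where "e' = e + d"
    have D': "row_mass_above \<rho> P i \<noteq> 0" if "i \<noteq> istar" for i
      using D[OF that] by (simp add: \<rho>_def defs)
    have P: "row_stochastic P" unfolding defs by (rule row_stochastic_plan[OF X])
    have Q: "row_stochastic Q" unfolding Q_def by (rule row_stochastic_sparsify[OF P D'])
    have "dist z y < r" using y by simp
    then have "0 < r" by (rule order_le_less_trans[OF zero_le_dist])
    then have "z \<in> ball z r" by simp
    \<comment> \<open>Both orientations are used: expanding at \<open>z\<close> bounds
      \<open>norm g\<close>, expanding at \<open>y\<close> bounds the residual.\<close>
    then have seg: "closed_segment y z \<subseteq> U" "closed_segment z y \<subseteq> U"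
      using y closed_segment_subset[OF _ _ convex_ball] ball by blast+
    have er: "norm e \<le> \<bar>r\<bar>" using y by (simp add: e_def dist_norm norm_minus_commute)
    have "norm (g - hess \<eta> a C X z *v e) \<le> \<bar>L\<bar> * (norm e)\<^sup>2"
      using grad_linearization[where X = X and b = b, OF eta X seg(2) lip] z(2)
      by (simp add: defs e_def)
    also have "\<dots> \<le> \<bar>L\<bar> * \<bar>r\<bar> * norm e"
      using er by (simp add: power2_eq_square mult.assoc mult_left_mono mult_right_mono)
    finally have "norm g \<le> \<bar>L\<bar> * \<bar>r\<bar> * norm e + norm (hess \<eta> a C X z *v e)"
      using norm_triangle_sub[of g "hess \<eta> a C X z *v e"] by linarith
    then have g: "norm g \<le> G * norm e"
      using onorm[OF bl, of "hess \<eta> a C X z" e] by (simp add: G_def distrib_right)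
    have "hess \<eta> a C X y *v (z - y) = - (hess_of_plan \<eta> a P *v e)"
      by (simp add: defs e_def hess_def matrix_vector_mult_diff_distrib)
    then have lin: "norm (hess_of_plan \<eta> a P *v e - g) \<le> \<bar>L\<bar> * (norm e)\<^sup>2"
      using grad_linearization[where X = X and b = b, OF eta X seg(1) lip] z(2)
      by (simp add: defs e_def norm_minus_commute[of z y])
    have rho: "\<rho> = \<eta> / (?m * ?N) * norm g" by (simp add: \<rho>_def threshold_def defs)
    have "norm (H *v e - hess_of_plan \<eta> a P *v e) \<le> ?N * ((2 + ?N) / \<eta>) * (?N * \<rho>) * norm e"
      unfolding H_def
    proof (rule hess_of_plan_diff_bound[OF P Q eta a])
      show "\<bar>Q $ i $ j - P $ i $ j\<bar> \<le> ?N * \<rho>" for i j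
        unfolding Q_def by (rule sparsify_diff_bound[OF P _ D']) (use eta in \<open>simp add: rho\<close>)
    qed
    also have "\<dots> = S * norm g * norm e" by (simp add: S_def rho mult.assoc)
    also have "\<dots> \<le> S * (G * norm e) * norm e"
      using g S0 by (intro mult_right_mono mult_left_mono) auto
    finally have sp: "norm (H *v e - hess_of_plan \<eta> a P *v e) \<le> S * G * (norm e)\<^sup>2"
      by (simp add: power2_eq_square mult.assoc)
    have sh: "norm (norm g *\<^sub>R e) \<le> G * (norm e)\<^sup>2"
      using mult_right_mono[OF g norm_ge_zero[of e]] by (simp add: power2_eq_square mult.assoc)
    have Hd: "H *v d + norm g *\<^sub>R d = - g"
      using newton_dir_equation[where X = X and b = b, OF eta a(1) X D]
      unfolding H_def Q_def \<rho>_def defs sparse_hess_def .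
    have "H *v e' + norm g *\<^sub>R e' = (H *v e + norm g *\<^sub>R e) + (H *v d + norm g *\<^sub>R d)"
      by (simp add: e'_def matrix_vector_right_distrib scaleR_add_right)
    also have "\<dots> = (H *v e - hess_of_plan \<eta> a P *v e) + norm g *\<^sub>R e
        + (hess_of_plan \<eta> a P *v e - g)"
      unfolding Hd by simp
    also have "norm \<dots> \<le> S * G * (norm e)\<^sup>2 + G * (norm e)\<^sup>2 + \<bar>L\<bar> * (norm e)\<^sup>2"
      by (intro norm_triangle_mono sp sh lin)
    finally have rhs: "norm (H *v e' + norm g *\<^sub>R e') \<le> c * (norm e)\<^sup>2"
      by (simp add: c_def distrib_right)
    have zd: "zero_sum d"
      unfolding defs by (rule zero_sum_newton_dir[where X = X, OF eta a b X D])
    have e'0: "zero_sum e'"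
      using zd zs z(1) by (simp add: zero_sum_def e'_def e_def sum.distrib sum_subtractf)
    \<comment> \<open>Coercivity applies because \<open>e'\<close> is zero-sum and row
      \<open>istar\<close> of \<open>Q\<close> equals that of the plan, so \<open>\<delta>\<close>
      bounds it from below.\<close>
    have "\<mu> * (norm e')\<^sup>2 \<le> e' \<bullet> (H *v e')"
      unfolding \<mu>_def H_def
      by (rule hess_of_plan_coercive[OF Q eta a(1) _ _ e'0])
        (use \<delta> y in \<open>auto simp: Q_def sparsify_def defs\<close>)
    also have "\<dots> \<le> e' \<bullet> (H *v e' + norm g *\<^sub>R e')" by (simp add: inner_add_right)
    also have "\<dots> \<le> norm e' * (c * (norm e)\<^sup>2)"
      by (rule order.trans[OF norm_cauchy_schwarz mult_left_mono[OF rhs norm_ge_zero]])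
    finally have "norm e' * (\<mu> * norm e') \<le> norm e' * (c * (norm e)\<^sup>2)"
      by (simp add: power2_eq_square mult_ac)
    then have "\<mu> * norm e' \<le> c * (norm e)\<^sup>2"
      using c0 by (cases "e' = 0") (auto simp: mult_le_cancel_left)
    then have "norm e' \<le> c / \<mu> * (norm e)\<^sup>2"
      using mu by (simp add: field_simps)
    then show ?thesis by (simp add: e'_def e_def defs algebra_simps)
  qed
  then show ?thesis using c0 mu by (intro exI[of _ "c / \<mu>"]) auto
qed

section \<open>From the ball to the whole slice, and along the run\<close>

text \<open>The constant does not depend on \<open>y\<close>, so one choice serves all iterates.
  That the direction is zero-sum is recorded for the induction along the run.\<close>

lemma newton_step_quadratic:
  fixes X C :: "real ^ 'n ^ 'm"
  assumes eta: "\<eta> > 0" and a: "\<And>i. a $ i > 0" "(\<Sum>i\<in>UNIV. a $ i) = 1"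
    and b: "(\<Sum>j\<in>UNIV. b $ j) = 1" and X: "\<And>i j. 0 < X $ i $ j"
    and min: "is_arg_min (semi_dual \<eta> a b C X) zero_sum z"
    and U: "z \<in> interior U"
    and lip: "\<And>x y. x \<in> U \<Longrightarrow> y \<in> U \<Longrightarrow>
      spectral_norm (hess \<eta> a C X x - hess \<eta> a C X y) \<le> L * norm (x - y)"
  shows "\<exists>K>0. \<forall>y. zero_sum y \<and>
    (\<forall>i. i \<noteq> istar \<longrightarrow> row_mass_above (threshold \<eta> a b C X y) (plan \<eta> C X y) i \<noteq> 0) \<longrightarrow>
    zero_sum (newton_dir \<eta> a b C X istar y) \<and>
    norm (y + newton_dir \<eta> a b C X istar y - z) \<le> K * (norm (y - z))\<^sup>2"
proof -
  note dir = eta a b X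
  let ?D = "\<lambda>y i. row_mass_above (threshold \<eta> a b C X y) (plan \<eta> C X y) i \<noteq> 0"
  let ?d = "newton_dir \<eta> a b C X istar"
  obtain r where r: "r > 0" "ball z r \<subseteq> U"
    using U by (auto simp: mem_interior)
  have "zero_sum z" using min by (simp add: is_arg_min_def)
  moreover have "grad \<eta> a b C X z = 0"
    by (rule grad_minimizer_eq_0[where X = X, OF dir(1,3,4,5) min])
  ultimately obtain K where K: "K \<ge> 0" "\<And>y. y \<in> ball z r \<Longrightarrow> zero_sum y \<Longrightarrow>
      (\<And>i. i \<noteq> istar \<Longrightarrow> ?D y i) \<Longrightarrow> norm (y + ?d y - z) \<le> K * (norm (y - z))\<^sup>2"
    using newton_step_local[where X = X and istar = istar, OF dir lip r(2)] by metis
  \<comment> \<open>\<open>K\<close> serves the ball. Outside it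
    \<open>norm (y - z) \<ge> r\<close>, so \<open>1 / r\<close> absorbs the distance itself and
    \<open>1 / r\<^sup>2\<close> the Newton step of length at most 1.\<close>
  define M where "M = K + 1 / r + 1 / r\<^sup>2"
  have "norm (y + ?d y - z) \<le> M * (norm (y - z))\<^sup>2"
    if y: "zero_sum y" and D: "\<And>i. i \<noteq> istar \<Longrightarrow> ?D y i" for y
  proof (cases "y \<in> ball z r")
    case True
    have "norm (y + ?d y - z) \<le> K * (norm (y - z))\<^sup>2"
      by (rule K(2)[OF True y D])
    also have "\<dots> \<le> M * (norm (y - z))\<^sup>2"
      using r(1) by (intro mult_right_mono) (simp_all add: M_def)
    finally show ?thesis .
  next
    case False
    let ?n = "norm (y - z)"
    have n: "1 \<le> ?n / r" using False r(1) by (simp add: dist_norm norm_minus_commute)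
    have "norm (?d y) \<le> 1"
      by (rule norm_newton_dir_le_one[where X = X, OF dir(1,2,5) D])
    then have "norm (y + ?d y - z) \<le> ?n + 1"
      using norm_triangle_ineq[of "y - z" "?d y"] by (simp add: algebra_simps)
    also have "\<dots> \<le> ?n * (?n / r) + (?n / r)\<^sup>2"
      using mult_left_mono[OF n norm_ge_zero] power_mono[OF n, of 2] by (intro add_mono) auto
    also have "\<dots> = (1 / r + 1 / r\<^sup>2) * ?n\<^sup>2"
      by (simp add: power2_eq_square distrib_right)
    also have "\<dots> \<le> M * ?n\<^sup>2"
      using K(1) by (intro mult_right_mono) (simp_all add: M_def)
    finally show ?thesis .
  qed
  moreover have "zero_sum (?d y)" if "\<And>i. i \<noteq> istar \<Longrightarrow> ?D y i" for y
    by (rule zero_sum_newton_dir[where X = X, OF dir that])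
  moreover have "M > 0" using K(1) r(1) by (simp add: M_def add_nonneg_pos add_pos_pos)
  ultimately show ?thesis by blast
qed

theorem theorem4p3:
  fixes C X :: "real ^ 'n ^ 'm" and a :: "real ^ 'm" and b :: "real ^ 'n"
    and \<eta> L_H :: real and istar :: 'm and \<zeta>0 :: "real ^ 'm"
    and \<gamma> :: "nat \<Rightarrow> real ^ 'n" and t :: "nat \<Rightarrow> real"
    and \<gamma>star :: "real ^ 'n" and U :: "(real ^ 'n) set"
  assumes "\<eta> > 0"
    and "\<And>i j. C $ i $ j \<ge> 0"
    and "\<And>i. a $ i > 0" and "(\<Sum>i\<in>UNIV. a $ i) = 1"
    and "\<And>j. b $ j > 0" and "(\<Sum>j\<in>UNIV. b $ j) = 1"
    and "\<And>i j. X $ i $ j > 0"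
    and "is_arg_max (\<lambda>i. a $ i) (\<lambda>_. True) istar"
    and run: "ibsn_inner_run \<eta> a b C X istar \<zeta>0 \<gamma> t"
    and denominators: "\<And>v i. v \<ge> 1 \<Longrightarrow> i \<noteq> istar \<Longrightarrow>
          row_mass_above (threshold \<eta> a b C X (\<gamma> v)) (plan \<eta> C X (\<gamma> v)) i \<noteq> 0"
    and minimizer: "is_arg_min (semi_dual \<eta> a b C X) zero_sum \<gamma>star"
    and neighborhood: "\<gamma>star \<in> interior U"
    and lipschitz: "\<And>x y. x \<in> U \<Longrightarrow> y \<in> U \<Longrightarrow>
          spectral_norm (hess \<eta> a C X x - hess \<eta> a C X y) \<le> L_H * norm (x - y)"
  shows "\<exists>L>0. \<forall>v\<ge>1. \<gamma> v \<in> U \<and> t v = 1 \<longrightarrow>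
           norm (\<gamma> (v + 1) - \<gamma>star) \<le> L * (norm (\<gamma> v - \<gamma>star))\<^sup>2"
proof -
  let ?d = "\<lambda>v. newton_dir \<eta> a b C X istar (\<gamma> v)"
  obtain L where L: "L > 0" "\<And>y. zero_sum y \<Longrightarrow>
      (\<And>i. i \<noteq> istar \<Longrightarrow> row_mass_above (threshold \<eta> a b C X y) (plan \<eta> C X y) i \<noteq> 0) \<Longrightarrow>
      zero_sum (newton_dir \<eta> a b C X istar y) \<and>
      norm (y + newton_dir \<eta> a b C X istar y - \<gamma>star) \<le> L * (norm (y - \<gamma>star))\<^sup>2"
    using newton_step_quadratic[where X = X and b = b and istar = istar,
        OF assms(1,3,4,6,7) minimizer neighborhood lipschitz] by metis
  have step: "\<gamma> (v + 1) = \<gamma> v + t v *\<^sub>R ?d v" if "v \<ge> 1" for v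
    using run that by (simp add: ibsn_inner_run_def Let_def)
  \<comment> \<open>Centering puts \<open>\<gamma> 1\<close> in the slice, and every later step
    moves along a zero-sum direction, whatever its step size.\<close>
  have zs: "zero_sum (\<gamma> v)" if "v \<ge> 1" for v
    using that
  proof (induction v rule: nat_induct_at_least)
    case base
    obtain \<gamma>' where "\<gamma> 1 = center \<gamma>'" using run by (auto simp: ibsn_inner_run_def)
    then show ?case by (simp add: zero_sum_def center_def sum_subtractf)
  next
    case (Suc v)
    then have "zero_sum (?d v)" using L(2) denominators by simp
    then show ?case
      using Suc step[of v] by (simp add: zero_sum_def sum.distrib sum_distrib_left[symmetric])
  qed
  have "norm (\<gamma> (v + 1) - \<gamma>star) \<le> L * (norm (\<gamma> v - \<gamma>star))\<^sup>2" if "v \<ge> 1" "t v = 1" for v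
    using L(2)[OF zs denominators] step that by simp
  then show ?thesis using L(1) by blast
qed

end
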